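(* For $n\ge 0$ let \[ a_n:= \sum_{k=0}^{\lfloor n/3\rfloor}\binom{2n-3k}{n}. \] Then for every integer $n\ge 3$, \[ 3(n+1)(7n-2)a_n -6(7n+5)(2n-1)a_{n-1} +(n+1)(7n-2)a_{n-2} -2(7n+5)(2n-1)a_{n-3}=0. \] *)

theory Defs
  imports Complex_Main
begin

(* On naturals n div 3 is the floor of n/3, and k <= n div 3 gives 3*k <= 2*n,
   so the subtraction never truncates. *)
definition a :: "nat \<Rightarrow> nat" where
  "a n = (\<Sum>k = 0..n div 3. (2 * n - 3 * k) choose n)"

end

theory Submission
  imports Defs
begin

text \<open>
  The sequence satisfies a two-term relation with a closed right-hand side: for \<open>n \<ge> 2\<close>,

    \<open>2 (n + 1) (3 a(n) + a(n-2)) = (7n + 5) (2n choose n)\<close>.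

  The stated recurrence is the combination of this relation at \<open>n\<close> and at \<open>n - 1\<close> that
  eliminates the central binomial coefficients, whose ratio is given by
  \<open>n (2n choose n) = 2 (2n - 1) (2n-2 choose n-1)\<close>.

  To see the relation, let \<open>T p m\<close> be the coefficient of \<open>x^m\<close> in
  \<open>1 / ((1 - x)^(p+1) (1 - x^3))\<close>. Then \<open>a(n) = T n n\<close>, and \<open>a(n-2)\<close> is the coefficient
  of \<open>x^n\<close> in \<open>x^2 (1 - x)^2 / ((1 - x)^(n+1) (1 - x^3))\<close>. Because of

    \<open>3 + x^2 (1 - x)^2 = (1 + x + x^2) + (2 - x) (1 - x^3)\<close>,

  the factor \<open>1 - x^3\<close> cancels in \<open>3 a(n) + a(n-2)\<close>, which is therefore the coefficient of
  \<open>x^n\<close> in \<open>1 / (1 - x)^(n+2) + (2 - x) / (1 - x)^(n+1)\<close>, that is,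

    \<open>3 a(n) + a(n-2) = (2n+1 choose n+1) + 2 (2n choose n) - (2n-1 choose n)\<close>.

  The proof carries this out without power series: multiplication by \<open>1 - x^3\<close>, \<open>1 - x\<close>
  and \<open>1 + x + x^2\<close> corresponds to the lemmas \<open>step3_sum_add3\<close>, \<open>step3_sum_Pascal\<close> and
  \<open>step3_sum_consecutive\<close>.
\<close>

text \<open>The sum of \<open>p + j choose p\<close> over all \<open>j \<le> m\<close> with \<open>j\<close> congruent to \<open>m\<close> modulo 3.\<close>

definition step3_sum :: "nat \<Rightarrow> nat \<Rightarrow> nat" where
  "step3_sum p m = (\<Sum>k = 0..m div 3. (p + (m - 3 * k)) choose p)"

lemma a_eq_step3_sum: "a n = step3_sum n n"
  unfolding a_def step3_sum_def by (intro sum.cong) (auto simp: mult_2)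

lemma step3_sum_add3:
  "step3_sum p (m + 3) = step3_sum p m + ((p + m + 3) choose p)"
proof -
  have "(m + 3) div 3 = Suc (m div 3)" by simp
  then show ?thesis
    unfolding step3_sum_def
    by (simp add: sum.atLeast0_atMost_Suc_shift add.assoc del: sum.cl_ivl_Suc)
qed

lemma step3_sum_small [simp]:
  "step3_sum p 0 = 1" "step3_sum p (Suc 0) = p + 1" "step3_sum p (Suc (Suc 0)) = (p + 2) choose p"
  by (simp_all add: step3_sum_def)

lemma step3_sum_consecutive:
  "step3_sum p m + step3_sum p (m + 1) + step3_sum p (m + 2) = (p + m + 3) choose (p + 1)"
proof (induction m)
  case 0
  have "(p + 3) choose (p + 1) = ((p + 2) choose p) + ((p + 2) choose (p + 1))"
    by (simp add: eval_nat_numeral)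
  moreover have "(p + 2) choose (p + 1) = p + 2"
    using binomial_symmetric[of "p + 1" "p + 2"] by simp
  ultimately show ?case by (simp add: eval_nat_numeral)
next
  case (Suc m)
  have "(p + Suc m + 3) choose (p + 1) = ((p + m + 3) choose p) + ((p + m + 3) choose (p + 1))"
    by (simp add: eval_nat_numeral)
  with Suc step3_sum_add3[of p m] show ?case by (simp add: eval_nat_numeral)
qed

lemma step3_sum_Pascal:
  "step3_sum (p + 1) (m + 1) = step3_sum p (m + 1) + step3_sum (p + 1) m"
proof (induction m rule: less_induct)
  case (less m)
  have pascal: "(p + 1 + (j + 1)) choose (p + 1)
      = ((p + (j + 1)) choose p) + ((p + 1 + j) choose (p + 1))" for j
    by simp
  consider "m = 0" | "m = 1" | "m = 2" | "m \<ge> 3"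
    by linarith
  then show ?case
  proof cases
    case 1
    then show ?thesis by simp
  next
    case 2
    then show ?thesis
      using binomial_symmetric[of p "p + 2"] binomial_symmetric[of "p + 1" "p + 2"] pascal[of 1]
      by (simp add: eval_nat_numeral)
  next
    case 3
    then show ?thesis
      using pascal[of 2] step3_sum_add3[of "p + 1" 0] step3_sum_add3[of p 0]
      by (simp add: eval_nat_numeral)
  next
    case 4
    then obtain j where "m = j + 3"
      by (metis add.commute le_Suc_ex)
    then show ?thesis
      using less.IH[of j] pascal[of "j + 3"] step3_sum_add3[of "p + 1" "j + 1"]
        step3_sum_add3[of p "j + 1"] step3_sum_add3[of "p + 1" j]
      by (simp add: algebra_simps eval_nat_numeral del: binomial_Suc_Suc)
  qed
qed

text \<open>
  Here and in the next lemma \<open>m\<close> is \<open>n - 2\<close>, so that no truncated subtraction occurs. The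
  cases \<open>n = 2\<close> and \<open>n = 3\<close> are computed, since the general argument uses \<open>T n (n-4)\<close>.
\<close>

lemma three_a_plus_a_binomials:
  "3 * a (m + 2) + a m + ((2 * m + 3) choose (m + 2))
     = ((2 * m + 5) choose (m + 3)) + 2 * ((2 * m + 4) choose (m + 2))"
proof -
  consider "m = 0" | "m = 1" | "m \<ge> 2"
    by linarith
  then show ?thesis
  proof cases
    case 1
    then show ?thesis by (simp add: a_eq_step3_sum eval_nat_numeral)
  next
    case 2
    then show ?thesis
      using step3_sum_add3[of 3 0] by (simp add: a_eq_step3_sum eval_nat_numeral)
  next
    case 3
    then obtain j where m: "m = j + 2"
      by (metis add.commute le_Suc_ex)
    define T where "T = step3_sum (j + 4)"
    \<comment> \<open>Multiplication by \<open>(1 - x)\<^sup>2\<close>: \<open>step3_sum (j + 2)\<close> is the second difference of \<open>T\<close>.\<close>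
    have "step3_sum (j + 2) (j + 2) + 2 * T (j + 1) = T (j + 2) + T j"
      using step3_sum_Pascal[of "j + 2" "j + 1"] step3_sum_Pascal[of "j + 3" "j + 1"]
        step3_sum_Pascal[of "j + 3" j]
      unfolding T_def by (simp add: eval_nat_numeral)
    moreover have "T (j + 4) = T (j + 1) + ((2 * j + 8) choose (j + 4))"
      using step3_sum_add3[of "j + 4" "j + 1"] unfolding T_def
      by (simp add: mult_2 eval_nat_numeral del: binomial_Suc_Suc)
    moreover have "T (j + 3) = T j + ((2 * j + 7) choose (j + 4))"
      using step3_sum_add3[of "j + 4" j] unfolding T_def
      by (simp add: mult_2 eval_nat_numeral del: binomial_Suc_Suc)
    moreover have "T (j + 2) + T (j + 3) + T (j + 4) = (2 * j + 9) choose (j + 5)"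
      using step3_sum_consecutive[of "j + 4" "j + 2"] unfolding T_def
      by (simp add: mult_2 eval_nat_numeral del: binomial_Suc_Suc)
    ultimately show ?thesis
      using m by (simp add: a_eq_step3_sum T_def eval_nat_numeral del: binomial_Suc_Suc)
  qed
qed

lemma three_a_plus_a:
  "2 * (m + 3) * (3 * a (m + 2) + a m) = (7 * m + 19) * ((2 * m + 4) choose (m + 2))"
proof -
  have "(m + 3) * ((2 * m + 5) choose (m + 3)) = (2 * m + 5) * ((2 * m + 4) choose (m + 2))"
    using Suc_times_binomial_eq[of "2 * m + 4" "m + 2"] by (simp add: eval_nat_numeral ac_simps)
  moreover have "2 * ((2 * m + 3) choose (m + 2)) = (2 * m + 4) choose (m + 2)"
    using binomial_symmetric[of "m + 1" "2 * m + 3"] by (simp add: eval_nat_numeral)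
  moreover have "2 * (m + 3) * (3 * a (m + 2) + a m)
        + (m + 3) * (2 * ((2 * m + 3) choose (m + 2)))
      = 2 * ((m + 3) * ((2 * m + 5) choose (m + 3)))
        + 4 * (m + 3) * ((2 * m + 4) choose (m + 2))"
    using arg_cong[OF three_a_plus_a_binomials[of m], of "\<lambda>t. 2 * (m + 3) * t"]
    by (simp add: algebra_simps)
  ultimately show ?thesis by (simp add: algebra_simps)
qed

lemma central_binomial_ratio:
  "(n + 1) * ((2 * n + 2) choose (n + 1)) = 2 * (2 * n + 1) * ((2 * n) choose n)"
proof -
  have "(n + 1) * ((2 * n + 1) choose (n + 1)) = (2 * n + 1) * ((2 * n) choose n)"
    using Suc_times_binomial_eq[of "2 * n" n] by (simp add: ac_simps)
  moreover have "(2 * n + 2) choose (n + 1) = 2 * ((2 * n + 1) choose (n + 1))"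
    using binomial_symmetric[of n "2 * n + 1"] by simp
  ultimately show ?thesis by (simp del: binomial_Suc_Suc)
qed

theorem theorem7p2:
  fixes n :: nat
  assumes "n \<ge> 3"
  shows "3 * (int n + 1) * (7 * int n - 2) * int (a n)
       - 6 * (7 * int n + 5) * (2 * int n - 1) * int (a (n - 1))
       + (int n + 1) * (7 * int n - 2) * int (a (n - 2))
       - 2 * (7 * int n + 5) * (2 * int n - 1) * int (a (n - 3)) = 0"
proof -
  obtain m where n: "n = m + 3"
    using assms by (metis add.commute le_Suc_ex)
  define N where "N = int n"
  define b b' where "b = 3 * int (a n) + int (a (n - 2))"
    and "b' = 3 * int (a (n - 1)) + int (a (n - 3))"
  define c c' where "c = int ((2 * n) choose n)" and "c' = int ((2 * n - 2) choose (n - 1))"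
  have b: "2 * (N + 1) * b = (7 * N + 5) * c"
    using arg_cong[OF three_a_plus_a[of "m + 1"], of int]
    unfolding N_def b_def c_def n by (simp add: eval_nat_numeral algebra_simps del: binomial_Suc_Suc)
  have b': "2 * N * b' = (7 * N - 2) * c'"
    using arg_cong[OF three_a_plus_a[of m], of int]
    unfolding N_def b'_def c'_def n by (simp add: eval_nat_numeral algebra_simps del: binomial_Suc_Suc)
  have c: "N * c = 2 * (2 * N - 1) * c'"
    using arg_cong[OF central_binomial_ratio[of "m + 2"], of int]
    unfolding N_def c_def c'_def n by (simp add: eval_nat_numeral algebra_simps del: binomial_Suc_Suc)
  \<comment> \<open>The factor \<open>2 * N\<close> makes the left-hand sides of \<open>b'\<close> and \<open>c\<close> appear; it is cancelled below.\<close>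
  have "2 * N * ((N + 1) * (7 * N - 2) * b - 2 * (7 * N + 5) * (2 * N - 1) * b')
      = (7 * N - 2) * N * (2 * (N + 1) * b) - 2 * (7 * N + 5) * (2 * N - 1) * (2 * N * b')"
    by (simp add: algebra_simps)
  also have "\<dots> = (7 * N - 2) * (7 * N + 5) * (N * c - 2 * (2 * N - 1) * c')"
    unfolding b b' by (simp add: algebra_simps)
  also have "\<dots> = 0"
    by (simp add: c)
  finally have "(N + 1) * (7 * N - 2) * b - 2 * (7 * N + 5) * (2 * N - 1) * b' = 0"
    using n by (simp add: N_def)
  then show ?thesis
    unfolding b_def b'_def N_def by (simp add: algebra_simps)
qed

end
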